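(* Let $G$ be an $r$-regular graph with $n$ vertices and $m$ edges, and $\alpha\in[0,1)$. Then $$P_{A_\alpha(S(G))}(\lambda)=(\lambda-2\alpha)^{m-n}(1-\alpha)^nP_{A_\alpha(G)}\!\left(\frac{\lambda^2-\alpha(r+2)\lambda+r(3\alpha-1)}{1-\alpha}\right)$$ and $$P_{A_\alpha(S(G))}(\lambda)=(\lambda-2\alpha)^{m-n}(1-\alpha)^{2n}P_{A(G)}\!\left(\frac{\lambda^2-\alpha(r+2)\lambda+r(\alpha^2+2\alpha-1)}{(1-\alpha)^2}\right).$$
   Context: For a simple graph $G$ with adjacency matrix $A(G)$ and diagonal degree matrix $D(G)$, $A_\alpha(G)=\alpha D(G)+(1-\alpha)A(G)$. For a square matrix $M$ of order $k$, $P_M(\lambda)=\det(\lambda I_k-M)$. The subdivision graph $S(G)$ is obtained from $G$ by inserting a new vertex on each edge of $G$. *)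

theory Defs
  imports Jordan_Normal_Form.Char_Poly
begin

record 'a sgraph =
  verts :: "'a set"
  edges :: "'a set set"

definition simple_graph :: "'a sgraph \<Rightarrow> bool" where
  "simple_graph G \<longleftrightarrow> finite (verts G) \<and> (\<forall>e\<in>edges G. e \<subseteq> verts G \<and> card e = 2)"

definition degree_of :: "'a sgraph \<Rightarrow> 'a \<Rightarrow> nat" where
  "degree_of G v = card {e \<in> edges G. v \<in> e}"

definition regular_graph :: "nat \<Rightarrow> 'a sgraph \<Rightarrow> bool" where
  "regular_graph r G \<longleftrightarrow> simple_graph G \<and> (\<forall>v\<in>verts G. degree_of G v = r)"

text \<open>In the subdivision graph, \<open>Inl v\<close> is the old vertex \<open>v\<close> and \<open>Inr e\<close> is the new vertex
  inserted on the edge \<open>e\<close>; each edge \<open>e = {u, v}\<close> is replaced by the two edges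
  \<open>{Inl u, Inr e}\<close> and \<open>{Inl v, Inr e}\<close>.\<close>

definition subdivision :: "'a sgraph \<Rightarrow> ('a + 'a set) sgraph" where
  "subdivision G =
     \<lparr> verts = Inl ` verts G \<union> Inr ` edges G,
       edges = {{Inl v, Inr e} | v e. e \<in> edges G \<and> v \<in> e} \<rparr>"

text \<open>Matrices of a graph are formed with respect to an enumeration of its vertices, i.e. a
  list \<open>vs\<close> that contains every vertex exactly once; row and column \<open>i\<close> belong to \<open>vs ! i\<close>.\<close>

definition vertex_enum :: "'a sgraph \<Rightarrow> 'a list \<Rightarrow> bool" where
  "vertex_enum G vs \<longleftrightarrow> distinct vs \<and> set vs = verts G"

definition adjacency_mat :: "'a sgraph \<Rightarrow> 'a list \<Rightarrow> real mat" where
  "adjacency_mat G vs = mat (length vs) (length vs)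
     (\<lambda>(i, j). if {vs ! i, vs ! j} \<in> edges G then 1 else 0)"

definition degree_mat :: "'a sgraph \<Rightarrow> 'a list \<Rightarrow> real mat" where
  "degree_mat G vs = mat (length vs) (length vs)
     (\<lambda>(i, j). if i = j then real (degree_of G (vs ! i)) else 0)"

definition A_alpha :: "real \<Rightarrow> 'a sgraph \<Rightarrow> 'a list \<Rightarrow> real mat" where
  "A_alpha \<alpha> G vs = \<alpha> \<cdot>\<^sub>m degree_mat G vs + (1 - \<alpha>) \<cdot>\<^sub>m adjacency_mat G vs"

end

theory Submission
  imports Defs
begin

text \<open>Listing old vertices before new ones, \<open>x I - A\<^sub>\<alpha>(S(G))\<close> is a two-by-two block matrix with scalar
  diagonal blocks \<open>(x - \<alpha> r) I\<close> and \<open>(x - 2 \<alpha>) I\<close> and off-diagonal blocks \<open>-(1 - \<alpha>) R\<close> and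
  its transpose, where \<open>R\<close> is the incidence matrix of \<open>G\<close>. The Schur complement, together with
  \<open>R R\<^sup>T = r I + A(G)\<close>, expresses its determinant through \<open>P\<^bsub>A(G)\<^esub>\<close>, first multiplied by
  \<open>(x - 2 \<alpha>)\<^sup>n\<close>; this factor cancels as a polynomial. The formula in \<open>P\<^bsub>A\<^sub>\<alpha>(G)\<^esub>\<close> follows from
  \<open>A\<^sub>\<alpha>(G) = \<alpha> r I + (1 - \<alpha>) A(G)\<close>.\<close>

section \<open>Characteristic polynomials and determinant identities\<close>

lemma poly_char_poly_det:
  fixes A :: "'a :: field mat"
  assumes "A \<in> carrier_mat n n"
  shows "poly (char_poly A) x = det (x \<cdot>\<^sub>m 1\<^sub>m n - A)"
proof -
  have "- char_matrix A x = x \<cdot>\<^sub>m 1\<^sub>m n - A"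
    using assms by (intro eq_matI) (auto simp: char_matrix_def)
  then show ?thesis
    using char_poly_matrix[OF assms] by simp
qed

text \<open>Pulling \<open>b\<close> out of the characteristic matrix leaves that of
  \<open>A\<close> at the shifted and rescaled point; the determinant turns the scalar into
  \<open>b ^ n\<close>.\<close>

lemma poly_char_poly_scalar_add_smult:
  fixes A :: "'a :: field mat"
  assumes "A \<in> carrier_mat n n" "b \<noteq> 0"
  shows "poly (char_poly (a \<cdot>\<^sub>m 1\<^sub>m n + b \<cdot>\<^sub>m A)) x = b ^ n * poly (char_poly A) ((x - a) / b)"
proof -
  have "x \<cdot>\<^sub>m 1\<^sub>m n - (a \<cdot>\<^sub>m 1\<^sub>m n + b \<cdot>\<^sub>m A) = b \<cdot>\<^sub>m (((x - a) / b) \<cdot>\<^sub>m 1\<^sub>m n - A)"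
    using assms by (intro eq_matI) (auto simp: field_simps)
  then show ?thesis
    using assms by (simp add: poly_char_poly_det[of _ n])
qed

lemma smult_smult_mat: "a \<cdot>\<^sub>m (b \<cdot>\<^sub>m A) = (a * b :: 'a :: semigroup_mult) \<cdot>\<^sub>m A"
  by (rule eq_matI) (auto simp: mult.assoc)

text \<open>Right multiplication by \<open>?N\<close>, whose determinant is \<open>c ^ n\<close>,
  clears the lower left block because \<open>c I\<close> commutes with \<open>C\<close>. Nothing is
  divided by \<open>c\<close>, so this Schur complement formula also covers
  \<open>c = 0\<close>.\<close>

lemma det_four_block_mat_scalar_lower_right:
  fixes A :: "'a :: idom mat"
  assumes A: "A \<in> carrier_mat n n" and B: "B \<in> carrier_mat n m" and C: "C \<in> carrier_mat m n"
  shows "c ^ n * det (four_block_mat A B C (c \<cdot>\<^sub>m 1\<^sub>m m)) = c ^ m * det (c \<cdot>\<^sub>m A - B * C)"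
proof -
  let ?M = "four_block_mat A B C (c \<cdot>\<^sub>m 1\<^sub>m m)"
  let ?N = "four_block_mat (c \<cdot>\<^sub>m 1\<^sub>m n) (0\<^sub>m n m) (- C) (1\<^sub>m m)"
  have "?M * ?N = four_block_mat (A * (c \<cdot>\<^sub>m 1\<^sub>m n) + B * (- C)) (A * 0\<^sub>m n m + B * 1\<^sub>m m)
      (C * (c \<cdot>\<^sub>m 1\<^sub>m n) + (c \<cdot>\<^sub>m 1\<^sub>m m) * (- C)) (C * 0\<^sub>m n m + (c \<cdot>\<^sub>m 1\<^sub>m m) * 1\<^sub>m m)"
    by (rule mult_four_block_mat[of _ n n _ m _ m]) (use A B C in auto)
  moreover have "A * (c \<cdot>\<^sub>m 1\<^sub>m n) + B * (- C) = c \<cdot>\<^sub>m A - B * C"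
    using A B C by (intro eq_matI) (auto simp: mult_smult_distrib[of _ _ n])
  moreover have "A * 0\<^sub>m n m + B * 1\<^sub>m m = B"
    using A B by auto
  moreover have "C * (c \<cdot>\<^sub>m 1\<^sub>m n) + (c \<cdot>\<^sub>m 1\<^sub>m m) * (- C) = 0\<^sub>m m n"
    using C by (intro eq_matI) (auto simp: mult_smult_distrib[of _ _ n] mult_smult_assoc_mat[of _ _ m])
  moreover have "C * 0\<^sub>m n m + (c \<cdot>\<^sub>m 1\<^sub>m m) * 1\<^sub>m m = c \<cdot>\<^sub>m 1\<^sub>m m"
    using C by auto
  ultimately have "?M * ?N = four_block_mat (c \<cdot>\<^sub>m A - B * C) B (0\<^sub>m m n) (c \<cdot>\<^sub>m 1\<^sub>m m)"
    by simp
  moreover have "det (four_block_mat (c \<cdot>\<^sub>m A - B * C) B (0\<^sub>m m n) (c \<cdot>\<^sub>m 1\<^sub>m m)) =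
      det (c \<cdot>\<^sub>m A - B * C) * c ^ m"
    using A B C by (subst det_four_block_mat_lower_left_zero[of _ n _ m]) auto
  moreover have "det (?M * ?N) = det ?M * det ?N"
    by (rule det_mult[of _ "n + m"]) (use A B C in auto)
  ultimately have "det ?M * det ?N = det (c \<cdot>\<^sub>m A - B * C) * c ^ m"
    by simp
  moreover have "det ?N = c ^ n"
    using C by (subst det_four_block_mat_upper_right_zero[of _ n _ m]) auto
  ultimately show ?thesis
    by (simp add: mult.commute)
qed

text \<open>The same permutation acts on rows and on columns, so its sign enters twice and squares
  to 1.\<close>

lemma det_permute_rows_columns:
  fixes A :: "'a :: comm_ring_1 mat"
  assumes A: "A \<in> carrier_mat n n" and p: "p permutes {0..<n}"
  shows "det (mat n n (\<lambda>(i, j). A $$ (p i, p j))) = det A"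
proof -
  have lt: "p i < n \<longleftrightarrow> i < n" for i
    using permutes_in_image[OF p, of i] by simp
  \<comment> \<open>Permuting the rows of the transpose permutes the columns of \<open>A\<close>, so
    the row rule serves for both.\<close>
  let ?T = "mat n n (\<lambda>(i, j). A\<^sup>T $$ (p i, j))"
  have "mat n n (\<lambda>(i, j). A $$ (p i, p j)) = mat n n (\<lambda>(i, j). ?T\<^sup>T $$ (p i, j))"
    using A lt by (intro eq_matI) auto
  then have "det (mat n n (\<lambda>(i, j). A $$ (p i, p j))) = signof p * det (?T\<^sup>T)"
    using det_permute_rows[of "?T\<^sup>T" n p] p by simp
  also have "det (?T\<^sup>T) = signof p * det (A\<^sup>T)"
    using det_permute_rows[of "A\<^sup>T" n p] A p by (simp add: det_transpose[of _ n])
  finally show ?thesis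
    using A by (simp add: det_transpose[of _ n] mult.assoc[symmetric] flip: of_int_mult)
qed

section \<open>Independence of the vertex enumeration\<close>

lemma A_alpha_carrier [simp]: "A_alpha \<alpha> G vs \<in> carrier_mat (length vs) (length vs)"
  by (simp add: A_alpha_def degree_mat_def adjacency_mat_def)

text \<open>Two enumerations differ by a permutation, which acts simultaneously on rows and columns.
  This allows an arbitrary enumeration of the subdivision to be replaced by one that lists old
  vertices first.\<close>

lemma char_poly_A_alpha_enum_cong:
  assumes vs: "vertex_enum G vs" and ws: "vertex_enum G ws"
  shows "poly (char_poly (A_alpha \<alpha> G vs)) x = poly (char_poly (A_alpha \<alpha> G ws)) x"
proof -
  have "mset vs = mset ws"
    using vs ws by (simp add: vertex_enum_def set_eq_iff_mset_eq_distinct[symmetric])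
  then obtain p where p: "p permutes {..<length ws}" and vs_eq: "permute_list p ws = vs"
    by (rule mset_eq_permutation)
  let ?n = "length ws"
  have len: "length vs = ?n"
    using vs_eq by auto
  have p': "p permutes {0..<?n}"
    using p by (simp add: atLeast0LessThan)
  have lt: "p i < ?n \<longleftrightarrow> i < ?n" for i
    using permutes_in_image[OF p, of i] by simp
  have inj: "p i = p j \<longleftrightarrow> i = j" for i j
    using permutes_inj[OF p] by (simp add: inj_eq)
  have nth: "vs ! i = ws ! p i" if "i < ?n" for i
    using permute_list_nth[OF p that] vs_eq by simp
  let ?M = "x \<cdot>\<^sub>m 1\<^sub>m ?n - A_alpha \<alpha> G ws"
  have "x \<cdot>\<^sub>m 1\<^sub>m ?n - A_alpha \<alpha> G vs = mat ?n ?n (\<lambda>(i, j). ?M $$ (p i, p j))"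
    by (rule eq_matI)
      (auto simp: A_alpha_def degree_mat_def adjacency_mat_def len lt inj nth)
  then show ?thesis
    using det_permute_rows_columns[OF _ p', of ?M] len
    by (simp add: poly_char_poly_det[of _ ?n] A_alpha_carrier[of \<alpha> G vs, unfolded len] minus_carrier_mat)
qed

section \<open>The incidence matrix\<close>

definition incidence_mat :: "'a list \<Rightarrow> 'a set list \<Rightarrow> real mat" where
  "incidence_mat vs es = mat (length vs) (length es) (\<lambda>(i, j). if vs ! i \<in> es ! j then 1 else 0)"

lemma incidence_mat_carrier [simp]: "incidence_mat vs es \<in> carrier_mat (length vs) (length es)"
  by (simp add: incidence_mat_def)

lemma simple_graph_finite_edges: "simple_graph G \<Longrightarrow> finite (edges G)"
  by (rule finite_subset[of _ "Pow (verts G)"]) (auto simp: simple_graph_def)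

text \<open>Entry \<open>(i, j)\<close> of the product counts the edges containing both vertices:
  the degree on the diagonal, and off it 1 or 0 according to adjacency.\<close>

lemma incidence_mat_mult_transpose:
  assumes G: "simple_graph G" and vs: "vertex_enum G vs"
    and es: "distinct es" "set es = edges G"
  shows "incidence_mat vs es * (incidence_mat vs es)\<^sup>T = degree_mat G vs + adjacency_mat G vs"
    (is "?R * _ = _")
proof (rule eq_matI)
  fix i j
  assume "i < dim_row (degree_mat G vs + adjacency_mat G vs)"
    and "j < dim_col (degree_mat G vs + adjacency_mat G vs)"
  then have ij: "i < length vs" "j < length vs"
    by (auto simp: adjacency_mat_def)
  let ?E = "{e \<in> edges G. vs ! i \<in> e \<and> vs ! j \<in> e}"
  have fin: "finite (edges G)"
    using G by (rule simple_graph_finite_edges)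
  have bij: "bij_betw ((!) es) {0..<length es} (edges G)"
    using es by (intro bij_betw_nth) auto
  have "(?R * ?R\<^sup>T) $$ (i, j) =
      (\<Sum>k = 0..<length es. if vs ! i \<in> es ! k \<and> vs ! j \<in> es ! k then 1 else 0)"
    using ij by (auto simp: incidence_mat_def scalar_prod_def intro!: sum.cong)
  also have "\<dots> = (\<Sum>e\<in>edges G. if vs ! i \<in> e \<and> vs ! j \<in> e then 1 else 0)"
    by (rule sum.reindex_bij_betw[OF bij])
  also have "\<dots> = real (card ?E)"
    using fin by (simp add: sum.If_cases Int_def)
  also have "\<dots> = (degree_mat G vs + adjacency_mat G vs) $$ (i, j)"
  proof (cases "i = j")
    case True
    \<comment> \<open>On the diagonal the pair collapses to a singleton, which is no edge, so the
      adjacency matrix contributes 0.\<close>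
    have "{vs ! i} \<notin> edges G"
      using G by (auto simp: simple_graph_def)
    then show ?thesis
      using True ij by (simp add: degree_mat_def adjacency_mat_def degree_of_def)
  next
    case False
    then have ne: "vs ! i \<noteq> vs ! j"
      using vs ij by (simp add: vertex_enum_def nth_eq_iff_index_eq)
    \<comment> \<open>A two-element edge containing two distinct vertices consists of exactly these,
      so the count is at most 1.\<close>
    have "e = {vs ! i, vs ! j}" if "e \<in> ?E" for e
      using that G ne by (auto simp: simple_graph_def card_2_iff)
    then have "?E = (if {vs ! i, vs ! j} \<in> edges G then {{vs ! i, vs ! j}} else {})"
      by auto
    then show ?thesis
      using False ij by (simp add: degree_mat_def adjacency_mat_def)
  qed
  finally show "(?R * ?R\<^sup>T) $$ (i, j) = (degree_mat G vs + adjacency_mat G vs) $$ (i, j)" .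
qed (auto simp: incidence_mat_def adjacency_mat_def)

section \<open>The subdivision graph in block form\<close>

lemma degree_of_subdivision_Inl: "degree_of (subdivision G) (Inl v) = degree_of G v"
proof -
  have "{e \<in> edges (subdivision G). Inl v \<in> e} = (\<lambda>e. {Inl v, Inr e}) ` {e \<in> edges G. v \<in> e}"
    by (auto simp: subdivision_def)
  moreover have "inj_on (\<lambda>e. {Inl v, Inr e}) {e \<in> edges G. v \<in> e}"
    by (auto simp: inj_on_def doubleton_eq_iff)
  ultimately show ?thesis
    by (simp add: degree_of_def card_image)
qed

lemma degree_of_subdivision_Inr:
  assumes "e \<in> edges G"
  shows "degree_of (subdivision G) (Inr e) = card e"
proof -
  have "{d \<in> edges (subdivision G). Inr e \<in> d} = (\<lambda>v. {Inl v, Inr e}) ` e"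
    using assms by (auto simp: subdivision_def)
  moreover have "inj_on (\<lambda>v. {Inl v, Inr e}) e"
    by (auto simp: inj_on_def doubleton_eq_iff)
  ultimately show ?thesis
    by (simp add: degree_of_def card_image)
qed

lemma subdivision_edge_iff:
  "{Inl u, Inl v} \<notin> edges (subdivision G)"
  "{Inr d, Inr e} \<notin> edges (subdivision G)"
  "{Inl v, Inr e} \<in> edges (subdivision G) \<longleftrightarrow> e \<in> edges G \<and> v \<in> e"
  "{Inr e, Inl v} \<in> edges (subdivision G) \<longleftrightarrow> e \<in> edges G \<and> v \<in> e"
  by (auto simp: subdivision_def doubleton_eq_iff)

lemma vertex_enum_subdivision:
  assumes "vertex_enum G vs" "distinct es" "set es = edges G"
  shows "vertex_enum (subdivision G) (map Inl vs @ map Inr es)"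
  using assms by (auto simp: vertex_enum_def subdivision_def distinct_map)

text \<open>Every edge of the subdivision joins an old vertex to a new one, so adjacency fills only
  the off-diagonal blocks. Old vertices keep their degree, and a new vertex has degree
  \<open>card e = 2\<close>, whence the scalar lower right block.\<close>

lemma A_alpha_subdivision:
  assumes G: "simple_graph G" and es: "set es = edges G"
  shows "A_alpha \<alpha> (subdivision G) (map Inl vs @ map Inr es) =
    four_block_mat (\<alpha> \<cdot>\<^sub>m degree_mat G vs) ((1 - \<alpha>) \<cdot>\<^sub>m incidence_mat vs es)
      ((1 - \<alpha>) \<cdot>\<^sub>m (incidence_mat vs es)\<^sup>T) ((2 * \<alpha>) \<cdot>\<^sub>m 1\<^sub>m (length es))"
proof -
  have "es ! k \<in> edges G" if "k < length es" for k
    using es that by auto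
  moreover from this have "card (es ! k) = 2" if "k < length es" for k
    using G that by (auto simp: simple_graph_def)
  ultimately show ?thesis
    by (intro eq_matI)
      (auto simp: A_alpha_def degree_mat_def adjacency_mat_def incidence_mat_def nth_append
        subdivision_edge_iff degree_of_subdivision_Inl degree_of_subdivision_Inr)
qed

section \<open>The determinant for regular graphs\<close>

lemma degree_mat_regular:
  assumes "regular_graph r G" "vertex_enum G vs"
  shows "degree_mat G vs = real r \<cdot>\<^sub>m 1\<^sub>m (length vs)"
  using assms by (intro eq_matI) (auto simp: degree_mat_def regular_graph_def vertex_enum_def)

text \<open>Keeping the factor \<open>(x - 2 * \<alpha>) ^ n\<close> on the left makes the identity
  valid for every \<open>x\<close>, including \<open>2 * \<alpha>\<close>, which the later
  cancellation of polynomials requires.\<close>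

lemma char_poly_subdivision_times_power:
  assumes reg: "regular_graph r G" and vs: "vertex_enum G vs"
    and es: "distinct es" "set es = edges G" and \<alpha>: "\<alpha> \<noteq> 1"
  defines "n \<equiv> length vs" and "m \<equiv> length es"
  shows "(x - 2 * \<alpha>) ^ n *
      poly (char_poly (A_alpha \<alpha> (subdivision G) (map Inl vs @ map Inr es))) x =
    (x - 2 * \<alpha>) ^ m * (1 - \<alpha>) ^ (2 * n) *
      poly (char_poly (adjacency_mat G vs))
        ((x\<^sup>2 - \<alpha> * (real r + 2) * x + real r * (\<alpha>\<^sup>2 + 2 * \<alpha> - 1)) / (1 - \<alpha>)\<^sup>2)"
    (is "_ * poly (char_poly ?S) x = _ * poly (char_poly ?A) ?y")
proof -
  let ?R = "incidence_mat vs es"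
  let ?c = "x - 2 * \<alpha>"
  have G: "simple_graph G"
    using reg by (simp add: regular_graph_def)
  have R: "?R \<in> carrier_mat n m" and A: "?A \<in> carrier_mat n n"
    by (simp_all add: n_def m_def adjacency_mat_def)
  have D: "degree_mat G vs = real r \<cdot>\<^sub>m 1\<^sub>m n"
    using degree_mat_regular[OF reg vs] by (simp add: n_def)
  have S: "?S = four_block_mat ((\<alpha> * real r) \<cdot>\<^sub>m 1\<^sub>m n) ((1 - \<alpha>) \<cdot>\<^sub>m ?R) ((1 - \<alpha>) \<cdot>\<^sub>m ?R\<^sup>T)
      ((2 * \<alpha>) \<cdot>\<^sub>m 1\<^sub>m m)"
    using A_alpha_subdivision[OF G es(2), of \<alpha> vs] by (simp add: D m_def smult_smult_mat)
  have S_carrier: "?S \<in> carrier_mat (n + m) (n + m)"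
    using R by (simp add: S)
  have block: "x \<cdot>\<^sub>m 1\<^sub>m (n + m) - ?S =
      four_block_mat ((x - \<alpha> * real r) \<cdot>\<^sub>m 1\<^sub>m n) ((\<alpha> - 1) \<cdot>\<^sub>m ?R) ((\<alpha> - 1) \<cdot>\<^sub>m ?R\<^sup>T)
        (?c \<cdot>\<^sub>m 1\<^sub>m m)"
    unfolding S using R by (intro eq_matI) (auto simp: algebra_simps)
  have RR: "((\<alpha> - 1) \<cdot>\<^sub>m ?R) * ((\<alpha> - 1) \<cdot>\<^sub>m ?R\<^sup>T) =
      (1 - \<alpha>)\<^sup>2 \<cdot>\<^sub>m (real r \<cdot>\<^sub>m 1\<^sub>m n + ?A)"
  proof -
    have "((\<alpha> - 1) \<cdot>\<^sub>m ?R) * ((\<alpha> - 1) \<cdot>\<^sub>m ?R\<^sup>T) =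
        (\<alpha> - 1) \<cdot>\<^sub>m ((\<alpha> - 1) \<cdot>\<^sub>m (?R * ?R\<^sup>T))"
      using R by (simp add: mult_smult_assoc_mat[of _ n m _ n] mult_smult_distrib[of _ n m _ n])
    then show ?thesis
      by (simp add: incidence_mat_mult_transpose[OF G vs es] D smult_smult_mat power2_eq_square
          algebra_simps)
  qed
  \<comment> \<open>The numerator of \<open>?y\<close> is the expansion of \<open>?c * (x - \<alpha>
    * real r) - (1 - \<alpha>)\<^sup>2 * real r\<close>.\<close>
  have schur: "?c \<cdot>\<^sub>m ((x - \<alpha> * real r) \<cdot>\<^sub>m 1\<^sub>m n) - (1 - \<alpha>)\<^sup>2 \<cdot>\<^sub>m (real r \<cdot>\<^sub>m 1\<^sub>m n + ?A) =
      (1 - \<alpha>)\<^sup>2 \<cdot>\<^sub>m (?y \<cdot>\<^sub>m 1\<^sub>m n - ?A)"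
  proof (rule eq_matI)
    fix i j
    assume "i < dim_row ((1 - \<alpha>)\<^sup>2 \<cdot>\<^sub>m (?y \<cdot>\<^sub>m 1\<^sub>m n - ?A))"
      and "j < dim_col ((1 - \<alpha>)\<^sup>2 \<cdot>\<^sub>m (?y \<cdot>\<^sub>m 1\<^sub>m n - ?A))"
    then have ij: "i < n" "j < n"
      using A by auto
    have "(1 - \<alpha>)\<^sup>2 * ?y = x\<^sup>2 - \<alpha> * (real r + 2) * x + real r * (\<alpha>\<^sup>2 + 2 * \<alpha> - 1)"
      using \<alpha> by simp
    then have "(1 - \<alpha>)\<^sup>2 * (?y - a) = ?c * (x - \<alpha> * real r) - (1 - \<alpha>)\<^sup>2 * (real r + a)" for a
      unfolding right_diff_distrib by (simp add: power2_eq_square algebra_simps)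
    then show "(?c \<cdot>\<^sub>m ((x - \<alpha> * real r) \<cdot>\<^sub>m 1\<^sub>m n) - (1 - \<alpha>)\<^sup>2 \<cdot>\<^sub>m (real r \<cdot>\<^sub>m 1\<^sub>m n + ?A)) $$ (i, j) =
      ((1 - \<alpha>)\<^sup>2 \<cdot>\<^sub>m (?y \<cdot>\<^sub>m 1\<^sub>m n - ?A)) $$ (i, j)"
      using ij A by (cases "i = j") simp_all
  qed (use A in auto)
  have "?c ^ n * poly (char_poly ?S) x =
      ?c ^ m * det (?c \<cdot>\<^sub>m ((x - \<alpha> * real r) \<cdot>\<^sub>m 1\<^sub>m n) -
        ((\<alpha> - 1) \<cdot>\<^sub>m ?R) * ((\<alpha> - 1) \<cdot>\<^sub>m ?R\<^sup>T))"
    unfolding poly_char_poly_det[OF S_carrier] block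
    by (rule det_four_block_mat_scalar_lower_right) (use R in auto)
  also have "\<dots> = ?c ^ m * ((1 - \<alpha>)\<^sup>2) ^ n * det (?y \<cdot>\<^sub>m 1\<^sub>m n - ?A)"
    unfolding RR schur using A by simp
  finally show ?thesis
    unfolding poly_char_poly_det[OF A] power_mult .
qed

section \<open>Cancelling the extra factor and relating the two formulas\<close>

theorem theorem7:
  fixes G :: "'a sgraph" and vs :: "'a list" and ws :: "('a + 'a set) list"
    and r n m :: nat and \<alpha> x :: real
  assumes "regular_graph r G"
    and "n = card (verts G)" and "m = card (edges G)"
    and "0 \<le> \<alpha>" and "\<alpha> < 1"
    and "vertex_enum G vs" and "vertex_enum (subdivision G) ws"
    and "m < n \<Longrightarrow> x \<noteq> 2 * \<alpha>"
  shows "poly (char_poly (A_alpha \<alpha> (subdivision G) ws)) x =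
           (x - 2 * \<alpha>) powi (int m - int n) * (1 - \<alpha>) ^ n *
           poly (char_poly (A_alpha \<alpha> G vs))
             ((x\<^sup>2 - \<alpha> * (real r + 2) * x + real r * (3 * \<alpha> - 1)) / (1 - \<alpha>))
       \<and> poly (char_poly (A_alpha \<alpha> (subdivision G) ws)) x =
           (x - 2 * \<alpha>) powi (int m - int n) * (1 - \<alpha>) ^ (2 * n) *
           poly (char_poly (adjacency_mat G vs))
             ((x\<^sup>2 - \<alpha> * (real r + 2) * x + real r * (\<alpha>\<^sup>2 + 2 * \<alpha> - 1)) / (1 - \<alpha>)\<^sup>2)"
proof -
  define y where "y = (x\<^sup>2 - \<alpha> * (real r + 2) * x + real r * (\<alpha>\<^sup>2 + 2 * \<alpha> - 1)) / (1 - \<alpha>)\<^sup>2"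
  let ?S = "A_alpha \<alpha> (subdivision G) ws" and ?A = "adjacency_mat G vs"
  have fin: "finite (edges G)"
    using assms(1) by (simp add: regular_graph_def simple_graph_finite_edges)
  then obtain es where es: "set es = edges G" "distinct es"
    using finite_distinct_list by blast
  have n: "n = length vs" and m: "m = length es"
    using assms(2,3,6) es distinct_card by (fastforce simp: vertex_enum_def)+
  have \<alpha>: "\<alpha> \<noteq> 1"
    using assms(5) by simp
  let ?T = "A_alpha \<alpha> (subdivision G) (map Inl vs @ map Inr es)"
  have ST: "poly (char_poly ?S) z = poly (char_poly ?T) z" for z
    by (rule char_poly_A_alpha_enum_cong[OF assms(7) vertex_enum_subdivision[OF assms(6) es(2,1)]])
  have key: "(z - 2 * \<alpha>) ^ n * poly (char_poly ?S) z = (z - 2 * \<alpha>) ^ m * (1 - \<alpha>) ^ (2 * n) *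
      poly (char_poly ?A)
        ((z\<^sup>2 - \<alpha> * (real r + 2) * z + real r * (\<alpha>\<^sup>2 + 2 * \<alpha> - 1)) / (1 - \<alpha>)\<^sup>2)" for z
    unfolding ST n m by (rule char_poly_subdivision_times_power[OF assms(1,6) es(2,1) \<alpha>])
  have second: "poly (char_poly ?S) x =
      (x - 2 * \<alpha>) powi (int m - int n) * (1 - \<alpha>) ^ (2 * n) * poly (char_poly ?A) y"
  proof (cases "m < n")
    \<comment> \<open>The exponent is negative here and \<open>powi\<close> would take the value 0
      at a zero base; the assumption on \<open>x\<close> excludes this and permits division by the
      power.\<close>
    case True
    then have "x - 2 * \<alpha> \<noteq> 0"
      using assms(8) by simp
    then show ?thesis
      using key[of x] by (simp add: power_int_diff y_def field_simps)
  next
    case False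
    \<comment> \<open>Here \<open>x = 2 * \<alpha>\<close> is allowed, so the factor is cancelled in
      the polynomial ring, an integral domain, and only then is \<open>x\<close> inserted.
      \<open>g\<close> is the argument of the characteristic polynomial of \<open>G\<close> as a
      polynomial in \<open>x\<close>.\<close>
    let ?l = "[:- 2 * \<alpha>, 1:]"
    define g where "g = Polynomial.smult (1 / (1 - \<alpha>)\<^sup>2)
      [:real r * (\<alpha>\<^sup>2 + 2 * \<alpha> - 1), - \<alpha> * (real r + 2), 1:]"
    have g: "poly g z =
        (z\<^sup>2 - \<alpha> * (real r + 2) * z + real r * (\<alpha>\<^sup>2 + 2 * \<alpha> - 1)) / (1 - \<alpha>)\<^sup>2" for z
      by (simp add: g_def power2_eq_square add_divide_distrib diff_divide_distrib algebra_simps)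
    let ?q = "?l ^ (m - n) * Polynomial.smult ((1 - \<alpha>) ^ (2 * n)) (pcompose (char_poly ?A) g)"
    have "(z - 2 * \<alpha>) ^ m = (z - 2 * \<alpha>) ^ n * (z - 2 * \<alpha>) ^ (m - n)" for z
      using False by (simp flip: power_add)
    then have "poly (?l ^ n * char_poly ?S) z = poly (?l ^ n * ?q) z" for z
      using key[of z] by (simp add: poly_pcompose g algebra_simps)
    \<comment> \<open>Real polynomials that agree at every point are equal, since the field is
      infinite.\<close>
    then have eq: "?l ^ n * char_poly ?S = ?l ^ n * ?q"
      by (intro poly_eq_poly_eq_iff[THEN iffD1] ext)
    have "?l ^ n \<noteq> 0"
      by simp
    from mult_left_cancel[THEN iffD1, OF this eq] have "char_poly ?S = ?q" .
    then have "poly (char_poly ?S) x =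
        (x - 2 * \<alpha>) ^ (m - n) * (1 - \<alpha>) ^ (2 * n) * poly (char_poly ?A) y"
      by (simp add: poly_pcompose g y_def)
    moreover have "int m - int n = int (m - n)"
      using False by simp
    ultimately show ?thesis
      by (simp only: power_int_of_nat)
  qed
  let ?w = "(x\<^sup>2 - \<alpha> * (real r + 2) * x + real r * (3 * \<alpha> - 1)) / (1 - \<alpha>)"
  have "A_alpha \<alpha> G vs = (\<alpha> * real r) \<cdot>\<^sub>m 1\<^sub>m n + (1 - \<alpha>) \<cdot>\<^sub>m ?A"
    by (simp add: A_alpha_def degree_mat_regular[OF assms(1,6)] n smult_smult_mat)
  then have "poly (char_poly (A_alpha \<alpha> G vs)) ?w =
      (1 - \<alpha>) ^ n * poly (char_poly ?A) ((?w - \<alpha> * real r) / (1 - \<alpha>))"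
    using \<alpha> by (simp only:) (rule poly_char_poly_scalar_add_smult, auto simp: adjacency_mat_def n)
  \<comment> \<open>The constant terms match because \<open>(3 * \<alpha> - 1) - \<alpha> * (1 -
    \<alpha>) = \<alpha>\<^sup>2 + 2 * \<alpha> - 1\<close>.\<close>
  moreover have "(?w - \<alpha> * real r) / (1 - \<alpha>) = y"
  proof -
    have "?w - \<alpha> * real r = (x\<^sup>2 - \<alpha> * (real r + 2) * x + real r * (\<alpha>\<^sup>2 + 2 * \<alpha> - 1)) / (1 - \<alpha>)"
      using \<alpha> by (simp add: field_simps power2_eq_square)
    then show ?thesis
      by (simp add: y_def power2_eq_square)
  qed
  \<comment> \<open>Of the \<open>2 * n\<close> factors \<open>1 - \<alpha>\<close>,
    \<open>n\<close> are absorbed in passing from the adjacency matrix to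
    \<open>A_alpha\<close>.\<close>
  ultimately have first: "poly (char_poly ?S) x =
      (x - 2 * \<alpha>) powi (int m - int n) * (1 - \<alpha>) ^ n * poly (char_poly (A_alpha \<alpha> G vs)) ?w"
    unfolding second by (simp only: mult_2 power_add mult.assoc)
  show ?thesis
    using first second unfolding y_def by blast
qed

end
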